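(* Let $q \in (1,2)$ be such that for all $y \in [0,1]$, $|\mathrm{sl}_q(y)| \in \{1,2^{\aleph_0}\}$. Then there exists an $s > 0$ depending only on $q$ such that for every $y\in[0,1]$ for which $\mathrm{sl}_q(y)$ is uncountable, $\dim_{\mathrm{H}}(\mathrm{sl}_q(y)) \geq s$.
   Context: For $q\in(1,2)$ define maps on $[0,1]^2$ (the Okamoto IFS) by $S_0(x,y) = \left(\frac{x}{3}, \frac{y}{q}\right)$, $S_1(x,y) = \left(\frac{x+1}{3}, \left(\frac{2}{q}-1\right)(1-y) + \left(1-\frac{1}{q}\right)\right)$, $S_2(x,y) = \left(\frac{x+2}{3}, \frac{y}{q} + \left(1-\frac{1}{q}\right)\right)$. $K_q$ is the unique nonempty compact subset of $[0,1]^2$ with $K_q = S_0(K_q)\cup S_1(K_q)\cup S_2(K_q)$. For $y\in[0,1]$ the horizontal slice at $y$ is $\mathrm{sl}_q(y) = \{x\in[0,1] : (x,y)\in K_q\}$. $|\cdot|$ denotes cardinality and $\dim_{\mathrm{H}}$ denotes Hausdorff dimension. *)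

theory Defs
  imports "HOL-Analysis.Analysis" "HOL-Library.Equipollence"
begin

section \<open>Hausdorff measure and Hausdorff dimension\<close>

text \<open>
  The convention at \<open>s = 0\<close> is \<open>(diam U)^0 = 1\<close> for nonempty \<open>U\<close> (recall \<open>0 powr 0 = 0\<close> in
  the library), so that the \<open>0\<close>-dimensional measure is counting measure.
\<close>

definition hausdorff_gauge :: "real \<Rightarrow> 'a::metric_space set \<Rightarrow> ennreal" where
  "hausdorff_gauge s U =
     (if U = {} then 0 else if s = 0 then 1 else ennreal (diameter U powr s))"

text \<open>
  Covers are sequences; finite covers are included because members may be empty.
  Boundedness of the members is required explicitly because \<^const>\<open>diameter\<close> is
  only meaningful on bounded sets.
\<close>

definition hausdorff_premeasure :: "real \<Rightarrow> real \<Rightarrow> 'a::metric_space set \<Rightarrow> ennreal" where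
  "hausdorff_premeasure s \<delta> A =
     Inf {(\<Sum>i. hausdorff_gauge s (U i)) | U :: nat \<Rightarrow> 'a set.
            A \<subseteq> (\<Union>i. U i) \<and> (\<forall>i. bounded (U i) \<and> diameter (U i) \<le> \<delta>)}"

definition hausdorff_measure :: "real \<Rightarrow> 'a::metric_space set \<Rightarrow> ennreal" where
  "hausdorff_measure s A = (SUP \<delta>\<in>{0<..}. hausdorff_premeasure s \<delta> A)"

definition hausdorff_dim :: "'a::metric_space set \<Rightarrow> ennreal" where
  "hausdorff_dim A = Inf {ennreal s | s. 0 \<le> s \<and> hausdorff_measure s A = 0}"


section \<open>The Okamoto IFS, its attractor and horizontal slices\<close>

definition okamoto_S0 :: "real \<Rightarrow> real \<times> real \<Rightarrow> real \<times> real" where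
  "okamoto_S0 q = (\<lambda>(x, y). (x / 3, y / q))"

definition okamoto_S1 :: "real \<Rightarrow> real \<times> real \<Rightarrow> real \<times> real" where
  "okamoto_S1 q = (\<lambda>(x, y). ((x + 1) / 3, (2 / q - 1) * (1 - y) + (1 - 1 / q)))"

definition okamoto_S2 :: "real \<Rightarrow> real \<times> real \<Rightarrow> real \<times> real" where
  "okamoto_S2 q = (\<lambda>(x, y). ((x + 2) / 3, y / q + (1 - 1 / q)))"

definition is_okamoto_attractor :: "real \<Rightarrow> (real \<times> real) set \<Rightarrow> bool" where
  "is_okamoto_attractor q K \<longleftrightarrow>
     K \<noteq> {} \<and> compact K \<and> K \<subseteq> {0..1} \<times> {0..1} \<and>
     K = okamoto_S0 q ` K \<union> okamoto_S1 q ` K \<union> okamoto_S2 q ` K"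

definition okamoto_attractor :: "real \<Rightarrow> (real \<times> real) set" where
  "okamoto_attractor q = (THE K. is_okamoto_attractor q K)"

definition okamoto_slice :: "real \<Rightarrow> real \<Rightarrow> real set" where
  "okamoto_slice q y = {x \<in> {0..1}. (x, y) \<in> okamoto_attractor q}"


subsection \<open>The attractor is well defined\<close>

lemma okamoto_contraction:
  assumes q: "1 < q" "q < 2"
  obtains c where "0 \<le> c" "c < 1"
    "\<And>f a b. f \<in> {okamoto_S0 q, okamoto_S1 q, okamoto_S2 q} \<Longrightarrow>
       dist (f a) (f b) \<le> c * dist a b"
proof
  define c where "c = max (1/3) (max (1/q) (2/q - 1))"
  have r: "1/3 \<le> c" "1/q \<le> c" "2/q - 1 \<le> c" by (auto simp: c_def)
  show c0: "0 \<le> c" using r(1) by linarith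
  show "c < 1" using q by (auto simp: c_def field_simps)
  have key: "dist (u, v) (u', v') \<le> c * dist (x, y) (x', y')"
    if "\<bar>u - u'\<bar> \<le> c * \<bar>x - x'\<bar>" "\<bar>v - v'\<bar> \<le> c * \<bar>y - y'\<bar>" for u v u' v' x y x' y' :: real
  proof -
    have "dist (u, v) (u', v') = sqrt (\<bar>u - u'\<bar>\<^sup>2 + \<bar>v - v'\<bar>\<^sup>2)"
      by (simp add: dist_Pair_Pair dist_real_def)
    also have "\<dots> \<le> sqrt ((c * \<bar>x - x'\<bar>)\<^sup>2 + (c * \<bar>y - y'\<bar>)\<^sup>2)"
      by (intro real_sqrt_le_mono add_mono power_mono that) auto
    also have "\<dots> = sqrt (c\<^sup>2 * ((x - x')\<^sup>2 + (y - y')\<^sup>2))"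
      by (simp add: power_mult_distrib algebra_simps)
    also have "\<dots> = c * dist (x, y) (x', y')"
      using c0 by (simp add: real_sqrt_mult dist_Pair_Pair dist_real_def)
    finally show ?thesis .
  qed
  have sc: "\<bar>u - u'\<bar> \<le> c * \<bar>x - x'\<bar>" if "u - u' = d * (x - x')" "\<bar>d\<bar> \<le> c"
    for u u' d x x' :: real
    using that by (simp add: abs_mult mult_right_mono)
  have p: "0 < 2/q - 1" using q by (simp add: field_simps)
  fix f :: "real \<times> real \<Rightarrow> real \<times> real" and a b :: "real \<times> real"
  assume f: "f \<in> {okamoto_S0 q, okamoto_S1 q, okamoto_S2 q}"
  obtain x y x' y' where ab: "a = (x, y)" "b = (x', y')" by (metis surj_pair)
  consider "f = okamoto_S0 q" | "f = okamoto_S1 q" | "f = okamoto_S2 q" using f by auto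
  then show "dist (f a) (f b) \<le> c * dist a b"
  proof cases
    case 1
    show ?thesis unfolding 1 ab okamoto_S0_def split
    proof (rule key)
      show "\<bar>x / 3 - x' / 3\<bar> \<le> c * \<bar>x - x'\<bar>"
        by (rule sc[where d = "1/3"]) (use r(1) in \<open>auto simp: add_divide_distrib diff_divide_distrib\<close>)
      show "\<bar>y / q - y' / q\<bar> \<le> c * \<bar>y - y'\<bar>"
        by (rule sc[where d = "1/q"]) (use r(2) q in \<open>auto simp: diff_divide_distrib\<close>)
    qed
  next
    case 2
    show ?thesis unfolding 2 ab okamoto_S1_def split
    proof (rule key)
      show "\<bar>(x + 1) / 3 - (x' + 1) / 3\<bar> \<le> c * \<bar>x - x'\<bar>"
        by (rule sc[where d = "1/3"]) (use r(1) in \<open>auto simp: add_divide_distrib diff_divide_distrib\<close>)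
      show "\<bar>(2/q - 1) * (1 - y) + (1 - 1/q) - ((2/q - 1) * (1 - y') + (1 - 1/q))\<bar> \<le> c * \<bar>y - y'\<bar>"
      proof (rule sc)
        show "(2/q - 1) * (1 - y) + (1 - 1/q) - ((2/q - 1) * (1 - y') + (1 - 1/q))
            = - (2/q - 1) * (y - y')" by algebra
        show "\<bar>- (2/q - 1)\<bar> \<le> c" using p r(3) by linarith
      qed
    qed
  next
    case 3
    show ?thesis unfolding 3 ab okamoto_S2_def split
    proof (rule key)
      show "\<bar>(x + 2) / 3 - (x' + 2) / 3\<bar> \<le> c * \<bar>x - x'\<bar>"
        by (rule sc[where d = "1/3"]) (use r(1) in \<open>auto simp: add_divide_distrib diff_divide_distrib\<close>)
      show "\<bar>y / q + (1 - 1/q) - (y' / q + (1 - 1/q))\<bar> \<le> c * \<bar>y - y'\<bar>"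
        by (rule sc[where d = "1/q"]) (use r(2) q in \<open>auto simp: diff_divide_distrib\<close>)
    qed
  qed
qed

lemma okamoto_attractor_le:
  assumes q: "1 < q" "q < 2" and K: "is_okamoto_attractor q K" and L: "is_okamoto_attractor q L"
  shows "K \<subseteq> L"
proof -
  obtain c where c: "0 \<le> c" "c < 1"
    "\<And>f a b. f \<in> {okamoto_S0 q, okamoto_S1 q, okamoto_S2 q} \<Longrightarrow>
       dist (f a) (f b) \<le> c * dist a b"
    using okamoto_contraction[OF q] by metis
  have Kp: "compact K" "K \<noteq> {}" "K = okamoto_S0 q ` K \<union> okamoto_S1 q ` K \<union> okamoto_S2 q ` K"
    and Lp: "closed L" "L \<noteq> {}" "L = okamoto_S0 q ` L \<union> okamoto_S1 q ` L \<union> okamoto_S2 q ` L"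
    using K L by (auto simp: is_okamoto_attractor_def compact_imp_closed)
  obtain x where x: "x \<in> K" "\<And>y. y \<in> K \<Longrightarrow> infdist y L \<le> infdist x L"
    using continuous_attains_sup[OF Kp(1,2) continuous_on_infdist[OF continuous_on_id], of L]
    by blast
  obtain f z where f: "f \<in> {okamoto_S0 q, okamoto_S1 q, okamoto_S2 q}" and z: "z \<in> K" "x = f z"
    using subsetD[OF equalityD1[OF Kp(3)] x(1)] by blast
  obtain l where l: "l \<in> L" "infdist z L = dist z l"
    using infdist_attains_inf[OF Lp(1,2)] by blast
  have "f l \<in> L" by (subst Lp(3)) (use f l(1) in blast)
  then have "infdist x L \<le> dist (f z) (f l)" using z(2) by (simp add: infdist_le)
  also have "\<dots> \<le> c * infdist z L" using c(3)[OF f] l(2) by simp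
  also have "\<dots> \<le> c * infdist x L" using x(2) z(1) c(1) by (simp add: mult_left_mono)
  finally have "(1 - c) * infdist x L \<le> 0" by (simp add: algebra_simps)
  then have "infdist x L \<le> 0" using c(2) by (simp add: mult_le_0_iff)
  then have "infdist y L = 0" if "y \<in> K" for y
    using x(2)[OF that] infdist_nonneg[of y L] by linarith
  then show ?thesis using Lp(1,2) in_closed_iff_infdist_zero by blast
qed

lemma okamoto_attractor_exists:
  assumes q: "1 < q" "q < 2"
  shows "\<exists>K. is_okamoto_attractor q K"
proof -
  let ?Q = "{0..1::real} \<times> {0..1::real}"
  define M where "M = {okamoto_S0 q, okamoto_S1 q, okamoto_S2 q}"
  define F where "F = (\<lambda>A. okamoto_S0 q ` A \<union> okamoto_S1 q ` A \<union> okamoto_S2 q ` A)"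
  define T where "T n = (F ^^ n) ?Q" for n
  define K where "K = (\<Inter>n. T n)"
  have p: "0 < 2/q - 1" using q by (simp add: field_simps)
  have cont: "continuous_on A f" if "f \<in> M" for f A
    using that q
    by (auto simp: M_def okamoto_S0_def okamoto_S1_def okamoto_S2_def case_prod_unfold
        intro!: continuous_intros)
  have inj: "f a = f b \<Longrightarrow> a = b" if "f \<in> M" for f a b
    using that q p
    by (auto simp: M_def okamoto_S0_def okamoto_S1_def okamoto_S2_def split: prod.splits)
  have Feq: "F A = (\<Union>f\<in>M. f ` A)" for A by (auto simp: F_def M_def)
  have Fmono: "A \<subseteq> B \<Longrightarrow> F A \<subseteq> F B" for A B by (auto simp: F_def)
  have FQ: "F ?Q \<subseteq> ?Q"
  proof -
    have S1: "(2/q - 1) * (1 - y) + (1 - 1/q) \<in> {0..1}" if "y \<in> {0..1}" for y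
    proof -
      have "0 \<le> (2/q - 1) * (1 - y)" "(2/q - 1) * (1 - y) \<le> (2/q - 1) * 1"
        using p that by (auto intro!: mult_left_mono simp del: mult_1_right)
      moreover have "(2/q - 1) * 1 + (1 - 1/q) = 1/q" "0 \<le> 1 - 1/q" "1/q \<le> 1"
        using q by (auto simp: field_simps)
      ultimately show ?thesis unfolding atLeastAtMost_iff by (smt (verit))
    qed
    have S02: "0 \<le> y / q \<and> y / q \<le> 1 / q" if "y \<in> {0..1}" for y
      using q that by (auto simp: field_simps)
    have q1: "1 / q \<le> 1" using q by simp
    have "f (x, y) \<in> ?Q" if "f \<in> M" and x: "x \<in> {0..1}" and y: "y \<in> {0..1}" for f x y
    proof -
      consider "f = okamoto_S0 q" | "f = okamoto_S1 q" | "f = okamoto_S2 q"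
        using \<open>f \<in> M\<close> by (auto simp: M_def)
      then show ?thesis
      proof cases
        case 1
        show ?thesis unfolding 1 okamoto_S0_def split mem_Times_iff fst_conv snd_conv
            atLeastAtMost_iff using x S02[OF y] q1 by auto
      next
        case 2
        show ?thesis unfolding 2 okamoto_S1_def split mem_Times_iff fst_conv snd_conv
          using x S1[OF y] by (intro conjI) auto
      next
        case 3
        have "0 \<le> y / q + (1 - 1/q)" "y / q + (1 - 1/q) \<le> 1"
          using S02[OF y] q1 by linarith+
        then show ?thesis unfolding 3 okamoto_S2_def split mem_Times_iff fst_conv snd_conv
            atLeastAtMost_iff using x by (intro conjI) auto
      qed
    qed
    then show ?thesis unfolding Feq by blast
  qed
  have T0: "T 0 = ?Q" and TS: "T (Suc n) = F (T n)" for n by (auto simp: T_def)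
  have step: "T (Suc n) \<subseteq> T n" for n
  proof (induction n)
    case 0 show ?case unfolding TS T0 by (rule FQ)
  next
    case (Suc n) show ?case by (subst (1 2) TS) (rule Fmono[OF Suc])
  qed
  have anti: "m \<le> n \<Longrightarrow> T n \<subseteq> T m" for m n
    by (rule lift_Suc_antimono_le[of T]) (use step in auto)
  have comp: "compact (T n)" for n
  proof (induction n)
    case 0 show ?case unfolding T0 by (intro compact_Times compact_Icc)
  next
    case (Suc n)
    have "finite M" by (simp add: M_def)
    then show ?case unfolding TS Feq
      by (intro compact_UN compact_continuous_image cont Suc.IH) auto
  qed
  have ne: "T n \<noteq> {}" for n by (induction n) (auto simp: T0 TS F_def)
  have "K \<noteq> {}" unfolding K_def
    by (rule compact_nest[OF comp ne]) (use anti in auto)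
  moreover have "compact K"
  proof -
    have "closed K" unfolding K_def using comp by (auto intro: compact_imp_closed)
    then have "compact (T 0 \<inter> K)" using comp by (rule compact_Int_closed[rotated])
    moreover have "T 0 \<inter> K = K" by (auto simp: K_def)
    ultimately show ?thesis by simp
  qed
  moreover have KQ: "K \<subseteq> ?Q" unfolding K_def using T0 by blast
  moreover have "K = F K"
  proof
    show "F K \<subseteq> K"
    proof -
      have "F K \<subseteq> T n" for n
      proof -
        have "F K \<subseteq> F (T n)" by (intro Fmono) (auto simp: K_def)
        then show ?thesis using step[of n] unfolding TS by blast
      qed
      then show ?thesis by (auto simp: K_def)
    qed
    show "K \<subseteq> F K"
    proof
      fix x assume x: "x \<in> K"
      have "\<exists>f\<in>M. x \<in> f ` T n" for n
      proof -
        have "x \<in> T (Suc n)" using x by (auto simp: K_def)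
        then show ?thesis unfolding TS Feq by blast
      qed
      then obtain g where g: "\<And>n. g n \<in> M" "\<And>n. x \<in> g n ` T n" by metis
      have "finite (range g)" by (rule finite_subset[of _ M]) (use g(1) in \<open>auto simp: M_def\<close>)
      then obtain f where f: "infinite {n. g n = f}"
        using pigeonhole_infinite[of UNIV g] by auto
      have "{n. g n = f} \<noteq> {}" using f by (metis finite.emptyI)
      then have "f \<in> M" using g(1) by blast
      have all: "x \<in> f ` T n" for n
      proof -
        obtain m where "n \<le> m" "g m = f"
          using f unfolding infinite_nat_iff_unbounded_le by blast
        then show ?thesis using g(2)[of m] anti[of n m] by blast
      qed
      obtain z where z: "x = f z" using all[of 0] by blast
      have "z \<in> T n" for n using all[of n] inj[OF \<open>f \<in> M\<close>] z by blast
      then have "z \<in> K" by (simp add: K_def)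
      then show "x \<in> F K" unfolding Feq using z \<open>f \<in> M\<close> by blast
    qed
  qed
  ultimately show ?thesis unfolding is_okamoto_attractor_def F_def by blast
qed

theorem ex1_okamoto_attractor:
  assumes "1 < q" "q < 2"
  shows "\<exists>!K. is_okamoto_attractor q K"
  using okamoto_attractor_exists[OF assms] okamoto_attractor_le[OF assms] by blast

corollary is_okamoto_attractor_okamoto_attractor:
  assumes "1 < q" "q < 2"
  shows "is_okamoto_attractor q (okamoto_attractor q)"
  unfolding okamoto_attractor_def by (rule theI'[OF ex1_okamoto_attractor[OF assms]])

end

theory Submission
  imports Defs
begin

text \<open>
  Reading the ternary digits of \<open>x\<close> one at a time replaces \<open>y\<close> by its image under one of the three
  expanding inverses of the vertical coordinate maps, and \<open>x\<close> lies in the slice at \<open>y\<close> exactly when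
  the resulting orbit can be kept inside \<open>[0, 1]\<close>. A choice of digit arises only when the orbit enters
  the switch region \<open>I = [1 - 1/q, 1/q]\<close>, where all three inverses stay in \<open>[0, 1]\<close>.

  Under the dichotomy no slice is empty, so every slice over \<open>I\<close> has a point in \<open>[0, 1/3]\<close> and one
  in \<open>[2/3, 1]\<close>, and is therefore uncountable. An uncountable set of reals has two separated
  uncountable parts, so the slice at a point of \<open>I\<close> contains scaled copies of uncountable slices in two separated ternary cylinders
  (\<open>uncountable_slice_splits\<close>), and each of these orbits returns to \<open>I\<close>. A priori the return times are
  unbounded: near \<open>0\<close> and \<open>1\<close> the orbit takes arbitrarily long. They become bounded because the
  returns can be taken to the \<^emph>\<open>interior\<close> of \<open>I\<close>
  (\<open>uncountable_slice_reaches_switch_interior\<close>): then the pair of words that works for \<open>y\<close> works for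
  all nearby points, and compactness of \<open>I\<close> yields finitely many pairs, with a common bound \<open>N\<close> on
  their lengths and a common gap \<open>g\<close> between the cylinders (\<open>switch_branches_uniformly\<close>).

  Hence a slice over \<open>I\<close> contains two separated copies, scaled by at least \<open>3\<^sup>-\<^sup>N\<close>, of slices
  over \<open>I\<close>. Iterating this gives, for \<open>s = log 2 / ((N + 1) log 3)\<close>, a uniform positive lower bound on
  the sum of the \<open>s\<close>-th powers of the radii of any finite cover by balls
  (\<open>switch_slice_cover_bound\<close>), hence dimension at least \<open>s\<close>
  (\<open>hausdorff_dim_ge_of_finite_ball_covers\<close>). Any other uncountable slice contains a scaled copy of a
  slice over \<open>I\<close>, and its dimension is therefore bounded below by the same \<open>s\<close>.
\<close>


section \<open>A lower bound for the Hausdorff dimension of compact sets of reals\<close>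

text \<open>
  Each member of a countable cover sits in an open ball, centred in it, whose radius barely exceeds
  its diameter; by compactness finitely many of these balls suffice. Diameters at most \<open>1\<close> make
  the estimate for the exponent \<open>s\<close> an estimate for every smaller exponent as well.
\<close>

lemma hausdorff_dim_ge_of_finite_ball_covers:
  fixes A :: "real set"
  assumes A: "compact A" and s: "0 < s" and c: "0 < c"
    and cover: "\<And>(F :: nat set) p r. finite F \<Longrightarrow> A \<subseteq> (\<Union>i\<in>F. cball (p i) (r i)) \<Longrightarrow>
                  c \<le> (\<Sum>i\<in>F. r i powr s)"
  shows "ennreal s \<le> hausdorff_dim A"
proof -
  have bound: "ennreal (c / 2) \<le> (\<Sum>i. hausdorff_gauge t (U i))"
    if t: "0 \<le> t" "t < s" and U: "A \<subseteq> (\<Union>i. U i)"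
      and Ub: "\<And>i. bounded (U i)" "\<And>i. diameter (U i) \<le> 1"
    for t and U :: "nat \<Rightarrow> real set"
  proof -
    define d where "d i = diameter (U i)" for i
    have d: "0 \<le> d i" "d i \<le> 1" for i
      using Ub by (auto simp: d_def diameter_ge_0)
    define \<epsilon> where "\<epsilon> i = (c / 4) * (1 / 2) ^ i" for i :: nat
    have \<epsilon>: "0 < \<epsilon> i" for i using c by (simp add: \<epsilon>_def)
    have \<epsilon>_sums: "\<epsilon> sums (c / 2)"
      unfolding \<epsilon>_def using sums_mult[OF geometric_sums[of "1/2 :: real"], of "c/4"] by simp
    \<comment> \<open>This radius satisfies \<open>r\<^sub>i\<^sup>s = d\<^sub>i\<^sup>s + \<epsilon>\<^sub>i\<close>, so that it exceeds \<open>d\<^sub>i\<close> at total cost \<open>c/2\<close>.\<close>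
    define r where "r i = (d i powr s + \<epsilon> i) powr (1 / s)" for i
    have r: "r i powr s = d i powr s + \<epsilon> i" for i
    proof -
      have "0 < d i powr s + \<epsilon> i" using \<epsilon>[of i] by (simp add: add_nonneg_pos)
      then show ?thesis using s by (simp add: r_def powr_powr)
    qed
    have dr: "d i < r i" for i
    proof (rule ccontr)
      assume "\<not> d i < r i"
      then have "r i powr s \<le> d i powr s" using s by (intro powr_mono2) (auto simp: r_def)
      then show False using r[of i] \<epsilon>[of i] by simp
    qed
    define p where "p i = (SOME x. x \<in> U i)" for i
    have "x \<in> ball (p i) (r i)" if "x \<in> U i" for x i
    proof -
      have "p i \<in> U i" unfolding p_def by (rule someI[of "\<lambda>x. x \<in> U i", OF that])
      then have "dist (p i) x \<le> d i"
        unfolding d_def using that by (rule diameter_bounded_bound[OF Ub(1)])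
      then show ?thesis using dr[of i] unfolding mem_ball by linarith
    qed
    then have "U i \<subseteq> ball (p i) (r i)" for i by (rule subsetI)
    then have "(\<Union>i. U i) \<subseteq> (\<Union>i. ball (p i) (r i))" by (rule UN_mono[OF subset_refl])
    with U have "A \<subseteq> (\<Union>i. ball (p i) (r i))" by (rule subset_trans)
    then obtain F where F: "finite F" "A \<subseteq> (\<Union>i\<in>F. ball (p i) (r i))"
      by (rule compactE_image[OF A, of UNIV "\<lambda>i. ball (p i) (r i)", OF open_ball])
    have "(\<Union>i\<in>F. ball (p i) (r i)) \<subseteq> (\<Union>i\<in>F. cball (p i) (r i))"
      by (rule UN_mono[OF subset_refl ball_subset_cball])
    with F(2) have "A \<subseteq> (\<Union>i\<in>F. cball (p i) (r i))" by (rule subset_trans)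
    then have "c \<le> (\<Sum>i\<in>F. r i powr s)" by (rule cover[OF F(1)])
    also have "\<dots> = (\<Sum>i\<in>F. d i powr s) + sum \<epsilon> F" by (simp add: r sum.distrib)
    also have "sum \<epsilon> F \<le> c / 2"
      unfolding sums_unique[OF \<epsilon>_sums]
      by (rule sum_le_suminf[OF sums_summable[OF \<epsilon>_sums] F(1)]) (rule less_imp_le[OF \<epsilon>])
    finally have "c / 2 \<le> (\<Sum>i\<in>F. d i powr s)" by simp
    then have "ennreal (c / 2) \<le> (\<Sum>i\<in>F. ennreal (d i powr s))"
      by (simp add: ennreal_leI)
    also have "\<dots> \<le> (\<Sum>i\<in>F. hausdorff_gauge t (U i))"
    proof (rule sum_mono)
      fix i
      have le: "d i powr s \<le> d i powr t" by (rule powr_mono') (use d t in auto)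
      have le1: "d i powr s \<le> 1" by (rule powr_le1) (use d s in auto)
      have "d i = 0" if "U i = {}" using that by (simp add: d_def)
      then show "ennreal (d i powr s) \<le> hausdorff_gauge t (U i)"
        using le le1 unfolding hausdorff_gauge_def d_def[symmetric]
        by (cases "U i = {}"; cases "t = 0") (simp_all add: ennreal_leI)
    qed
    also have "\<dots> \<le> (\<Sum>i. hausdorff_gauge t (U i))"
      by (rule sum_le_suminf) (use F in auto)
    finally show ?thesis .
  qed
  have "s \<le> t" if t: "0 \<le> t" "hausdorff_measure t A = 0" for t
  proof (rule ccontr)
    assume "\<not> s \<le> t"
    then have "ennreal (c / 2) \<le> hausdorff_premeasure t 1 A"
      unfolding hausdorff_premeasure_def using bound t(1) by (intro Inf_greatest) auto
    also have "\<dots> \<le> hausdorff_measure t A"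
      unfolding hausdorff_measure_def by (rule SUP_upper) simp
    finally show False using t(2) c by (simp add: ennreal_eq_0_iff)
  qed
  then show ?thesis unfolding hausdorff_dim_def by (intro Inf_greatest) (auto intro: ennreal_leI)
qed

text \<open>
  Let \<open>\<alpha>\<close> be the infimum of the \<open>z\<close> with uncountably many points of \<open>E\<close> to the left of \<open>z\<close>, and
  \<open>\<beta>\<close> the supremum of those with uncountably many points to the right. Only countably many
  points lie below \<open>\<alpha>\<close> or above \<open>\<beta>\<close>, so \<open>\<beta> \<le> \<alpha>\<close> would make \<open>E\<close> countable; any two points
  strictly between \<open>\<alpha>\<close> and \<open>\<beta>\<close> separate.
\<close>

lemma uncountable_real_separated_parts:
  fixes E :: "real set"
  assumes E: "uncountable E" "bounded E"
  obtains a b where "a < b" "uncountable (E \<inter> {..a})" "uncountable (E \<inter> {b..})"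
proof -
  define X where "X = {z. uncountable (E \<inter> {..z})}"
  define Y where "Y = {z. uncountable (E \<inter> {z..})}"
  obtain B where B: "\<And>x. x \<in> E \<Longrightarrow> \<bar>x\<bar> \<le> B" using E(2) by (auto simp: bounded_real)
  have "E \<inter> {..B} = E" "E \<inter> {-B..} = E" using B by (force simp: abs_le_iff)+
  then have ne: "B \<in> X" "-B \<in> Y" using E(1) by (auto simp: X_def Y_def)
  have lo: "- B \<le> z" if "z \<in> X" for z
  proof (rule ccontr)
    assume "\<not> - B \<le> z"
    then have "E \<inter> {..z} = {}" using B by (force simp: abs_le_iff)
    then show False using that by (simp add: X_def)
  qed
  have hi: "z \<le> B" if "z \<in> Y" for z
  proof (rule ccontr)
    assume "\<not> z \<le> B"
    then have "E \<inter> {z..} = {}" using B by (force simp: abs_le_iff)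
    then show False using that by (simp add: Y_def)
  qed
  have bdd: "bdd_below X" "bdd_above Y" 
    by (rule bdd_belowI[of _ "- B"], erule lo) (rule bdd_aboveI[of _ B], erule hi)
  have left: "countable (E \<inter> {..<Inf X})"
  proof -
    have "countable (E \<inter> {..z})" if "z < Inf X" for z
      using that cInf_lower[OF _ bdd(1)] by (force simp: X_def)
    then have "countable (\<Union>n::nat. E \<inter> {..Inf X - 1 / real (Suc n)})" by (intro countable_UN) auto
    moreover have "E \<inter> {..<Inf X} \<subseteq> (\<Union>n::nat. E \<inter> {..Inf X - 1 / real (Suc n)})"
    proof
      fix x assume x: "x \<in> E \<inter> {..<Inf X}"
      then obtain n where "1 / real (Suc n) < Inf X - x" using nat_approx_posE[of "Inf X - x"] by auto
      then show "x \<in> (\<Union>n::nat. E \<inter> {..Inf X - 1 / real (Suc n)})"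
        using x by (intro UN_I[of n]) auto
    qed
    ultimately show ?thesis by (rule countable_subset[rotated])
  qed
  have right: "countable (E \<inter> {Sup Y<..})"
  proof -
    have "countable (E \<inter> {z..})" if "Sup Y < z" for z
      using that cSup_upper[OF _ bdd(2)] by (force simp: Y_def)
    then have "countable (\<Union>n::nat. E \<inter> {Sup Y + 1 / real (Suc n)..})" by (intro countable_UN) auto
    moreover have "E \<inter> {Sup Y<..} \<subseteq> (\<Union>n::nat. E \<inter> {Sup Y + 1 / real (Suc n)..})"
    proof
      fix x assume x: "x \<in> E \<inter> {Sup Y<..}"
      then obtain n where "1 / real (Suc n) < x - Sup Y" using nat_approx_posE[of "x - Sup Y"] by auto
      then show "x \<in> (\<Union>n::nat. E \<inter> {Sup Y + 1 / real (Suc n)..})"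
        using x by (intro UN_I[of n]) auto
    qed
    ultimately show ?thesis by (rule countable_subset[rotated])
  qed
  have "Inf X < Sup Y"
  proof (rule ccontr)
    assume "\<not> Inf X < Sup Y"
    then have "E \<subseteq> (E \<inter> {..<Inf X}) \<union> (E \<inter> {Sup Y<..}) \<union> {Inf X}" by auto
    moreover have "countable \<dots>" using left right by simp
    ultimately show False using E(1) countable_subset by blast
  qed
  then obtain a where a: "Inf X < a" "a < Sup Y" using dense by blast
  then obtain b where b: "a < b" "b < Sup Y" using dense by blast
  obtain x where x: "x \<in> X" "x < a" using a(1) ne(1) cInf_lessD by blast
  obtain y where y: "y \<in> Y" "b < y" using b(2) ne(2) less_cSupD by blast
  have sub: "E \<inter> {..x} \<subseteq> E \<inter> {..a}" "E \<inter> {y..} \<subseteq> E \<inter> {b..}" using x y by auto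
  have "uncountable (E \<inter> {..a})" using x(1) countable_subset[OF sub(1)] unfolding X_def by blast
  moreover have "uncountable (E \<inter> {b..})"
    using y(1) countable_subset[OF sub(2)] unfolding Y_def by blast
  ultimately show thesis by (rule that[OF b(1)])
qed


section \<open>Symbolic coding of the slices\<close>

datatype digit = Lo | Mid | Hi

instance digit :: countable by countable_datatype

fun digit_val :: "digit \<Rightarrow> real" where
  "digit_val Lo = 0"
| "digit_val Mid = 1"
| "digit_val Hi = 2"

text \<open>
  The affine parametrization of the ternary cylinder with address \<open>w\<close>.
\<close>

fun x_map :: "digit list \<Rightarrow> real \<Rightarrow> real" where
  "x_map [] x = x"
| "x_map (d # w) x = (x_map w x + digit_val d) / 3"

text \<open>
  The inverses of the second coordinates of the three maps of the Okamoto system.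
\<close>

fun y_inv :: "real \<Rightarrow> digit \<Rightarrow> real \<Rightarrow> real" where
  "y_inv q Lo y = q * y"
| "y_inv q Mid y = (1 - q * y) / (2 - q)"
| "y_inv q Hi y = q * y - (q - 1)"

fun y_inv_word :: "real \<Rightarrow> digit list \<Rightarrow> real \<Rightarrow> real" where
  "y_inv_word q [] y = y"
| "y_inv_word q (d # w) y = y_inv_word q w (y_inv q d y)"

lemma digit_val_bounds: "0 \<le> digit_val d" "digit_val d \<le> 2"
  by (cases d; simp)+

lemma x_map_affine: "x_map w x = x_map w 0 + x / 3 ^ length w"
  by (induction w) (simp_all add: add_divide_distrib)

lemma x_map_append: "x_map (w @ v) x = x_map w (x_map v x)"
  by (induction w) auto

lemma x_map_in_unit: "x \<in> {0..1} \<Longrightarrow> x_map w x \<in> {0..1}"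
proof (induction w)
  case (Cons d w)
  then show ?case using digit_val_bounds[of d] by auto
qed simp

lemma x_map_mono: "x \<le> x' \<Longrightarrow> x_map w x \<le> x_map w x'"
  using x_map_affine[of w x] x_map_affine[of w x'] by (simp add: divide_right_mono)

lemma x_map_dist: "\<bar>x_map w x - x_map w x'\<bar> = \<bar>x - x'\<bar> / 3 ^ length w"
  using x_map_affine[of w x] x_map_affine[of w x'] by (simp flip: diff_divide_distrib)

lemma y_inv_word_append: "y_inv_word q (w @ v) y = y_inv_word q v (y_inv_word q w y)"
  by (induction w arbitrary: y) auto

lemma continuous_on_y_inv_word: "continuous_on UNIV (y_inv_word q w)"
proof (induction w)
  case (Cons d w)
  have "continuous_on UNIV (y_inv q d)"
    by (cases d) (auto simp: divide_inverse intro!: continuous_intros)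
  then have "continuous_on UNIV (y_inv_word q w \<circ> y_inv q d)"
    by (rule continuous_on_compose) (rule continuous_on_subset[OF Cons.IH subset_UNIV])
  then show ?case by (simp add: o_def)
qed (simp add: continuous_on_id)

locale okamoto =
  fixes q :: real
  assumes q: "1 < q" "q < 2"
begin

abbreviation slice :: "real \<Rightarrow> real set" where
  "slice \<equiv> okamoto_slice q"

text \<open>
  The overlap of the images of \<open>[0, 1]\<close> under the three vertical maps; it is the image of the middle
  one.
\<close>

definition switch :: "real set" where
  "switch = {1 - 1 / q..1 / q}"

definition switch_interior :: "real set" where
  "switch_interior = {1 - 1 / q<..<1 / q}"

lemma slice_subset_unit: "slice y \<subseteq> {0..1}"
  by (auto simp: okamoto_slice_def)

lemma slice_outside: "y \<notin> {0..1} \<Longrightarrow> slice y = {}"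
  using is_okamoto_attractor_okamoto_attractor[OF q]
  by (auto simp: okamoto_slice_def is_okamoto_attractor_def)

lemma compact_slice: "compact (slice y)"
proof -
  have K: "compact (okamoto_attractor q)"
    using is_okamoto_attractor_okamoto_attractor[OF q] by (simp add: is_okamoto_attractor_def)
  have "closed ((\<lambda>x. (x, y)) -` okamoto_attractor q)"
    by (intro closed_vimage compact_imp_closed[OF K] continuous_intros)
  then have "compact ({0..1} \<inter> (\<lambda>x. (x, y)) -` okamoto_attractor q)"
    by (intro compact_Int_closed compact_Icc)
  moreover have "slice y = {0..1} \<inter> (\<lambda>x. (x, y)) -` okamoto_attractor q"
    by (auto simp: okamoto_slice_def)
  ultimately show ?thesis by simp
qed

text \<open>
  The equation \<open>K = S\<^sub>0(K) \<union> S\<^sub>1(K) \<union> S\<^sub>2(K)\<close>, read on a horizontal line.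
\<close>

lemma slice_rec:
  "x \<in> slice y \<longleftrightarrow> (\<exists>d x'. x = (x' + digit_val d) / 3 \<and> x' \<in> slice (y_inv q d y))"
proof -
  define K where "K = okamoto_attractor q"
  have "is_okamoto_attractor q K"
    unfolding K_def by (rule is_okamoto_attractor_okamoto_attractor[OF q])
  then have sub: "K \<subseteq> {0..1} \<times> {0..1}"
    and K_eq: "K = okamoto_S0 q ` K \<union> okamoto_S1 q ` K \<union> okamoto_S2 q ` K"
    by (simp_all add: is_okamoto_attractor_def)
  have mem: "x \<in> slice z \<longleftrightarrow> (x, z) \<in> K" for x z
    using sub by (auto simp: okamoto_slice_def K_def)
  have inv: "z / q = y \<longleftrightarrow> z = y_inv q Lo y"
    "(2 / q - 1) * (1 - z) + (1 - 1 / q) = y \<longleftrightarrow> z = y_inv q Mid y"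
    "z / q + (1 - 1 / q) = y \<longleftrightarrow> z = y_inv q Hi y" for z
  proof -
    have "z / q + (1 - 1 / q) = (z + (q - 1)) / q" using q by (simp add: diff_divide_distrib add_divide_distrib)
    then have "z / q + (1 - 1 / q) = y \<longleftrightarrow> z + (q - 1) = q * y"
      using q by (simp add: divide_eq_eq mult.commute)
    then show "z / q + (1 - 1 / q) = y \<longleftrightarrow> z = y_inv q Hi y" by auto
    have "(2 / q - 1) * (1 - z) + (1 - 1 / q) = ((2 - q) * (1 - z) + (q - 1)) / q"
      using q by (simp add: diff_divide_distrib add_divide_distrib left_diff_distrib)
    then have "(2 / q - 1) * (1 - z) + (1 - 1 / q) = y \<longleftrightarrow> (2 - q) * (1 - z) + (q - 1) = y * q"
      using q by (simp add: divide_eq_eq)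
    also have "\<dots> \<longleftrightarrow> z * (2 - q) = 1 - q * y"
    proof -
      have "(2 - q) * (1 - z) + (q - 1) - y * q = (1 - q * y) - z * (2 - q)"
        by (simp add: algebra_simps)
      then show ?thesis by (intro iffI) linarith+
    qed
    finally show "(2 / q - 1) * (1 - z) + (1 - 1 / q) = y \<longleftrightarrow> z = y_inv q Mid y"
      using q by (simp add: eq_divide_eq)
    show "z / q = y \<longleftrightarrow> z = y_inv q Lo y" using q by (auto simp: divide_eq_eq)
  qed
  show ?thesis
  proof
    assume "x \<in> slice y"
    then have "(x, y) \<in> okamoto_S0 q ` K \<union> okamoto_S1 q ` K \<union> okamoto_S2 q ` K"
      using equalityD1[OF K_eq] mem by blast
    then obtain x' z where z: "(x', z) \<in> K"
      "(x, y) = okamoto_S0 q (x', z) \<or> (x, y) = okamoto_S1 q (x', z) \<or> (x, y) = okamoto_S2 q (x', z)"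
      by auto
    have "\<exists>d. x = (x' + digit_val d) / 3 \<and> z = y_inv q d y"
      using z(2)
    proof (elim disjE)
      assume "(x, y) = okamoto_S0 q (x', z)"
      then show ?thesis using inv(1)[of z] by (intro exI[of _ Lo]) (simp add: okamoto_S0_def)
    next
      assume "(x, y) = okamoto_S1 q (x', z)"
      then show ?thesis using inv(2)[of z] by (intro exI[of _ Mid]) (simp add: okamoto_S1_def)
    next
      assume "(x, y) = okamoto_S2 q (x', z)"
      then show ?thesis using inv(3)[of z] by (intro exI[of _ Hi]) (simp add: okamoto_S2_def)
    qed
    then show "\<exists>d x'. x = (x' + digit_val d) / 3 \<and> x' \<in> slice (y_inv q d y)"
      using z(1) mem by blast
  next
    assume "\<exists>d x'. x = (x' + digit_val d) / 3 \<and> x' \<in> slice (y_inv q d y)"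
    then obtain d x' where d: "x = (x' + digit_val d) / 3" "(x', y_inv q d y) \<in> K"
      using mem by blast
    have "(x, y) \<in> okamoto_S0 q ` K \<union> okamoto_S1 q ` K \<union> okamoto_S2 q ` K"
    proof (cases d)
      case Lo
      then have "(x, y) = okamoto_S0 q (x', y_inv q d y)"
        using d(1) inv(1)[of "y_inv q d y"] by (simp add: okamoto_S0_def)
      then show ?thesis using d(2) by blast
    next
      case Mid
      then have "(x, y) = okamoto_S1 q (x', y_inv q d y)"
        using d(1) inv(2)[of "y_inv q d y"] by (simp add: okamoto_S1_def)
      then show ?thesis using d(2) by blast
    next
      case Hi
      then have "(x, y) = okamoto_S2 q (x', y_inv q d y)"
        using d(1) inv(3)[of "y_inv q d y"] by (simp add: okamoto_S2_def)
      then show ?thesis using d(2) by blast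
    qed
    then show "x \<in> slice y" using equalityD2[OF K_eq] mem by blast
  qed
qed

lemma slice_words: "slice y = (\<Union>w\<in>{w. length w = n}. x_map w ` slice (y_inv_word q w y))"
proof (induction n arbitrary: y)
  case (Suc n)
  show ?case
  proof (intro set_eqI iffI)
    fix x assume "x \<in> slice y"
    then obtain d x' where d: "x = (x' + digit_val d) / 3" "x' \<in> slice (y_inv q d y)"
      using slice_rec[of x y] by blast
    then obtain w x'' where "length w = n" "x' = x_map w x''"
      "x'' \<in> slice (y_inv_word q w (y_inv q d y))"
      using equalityD1[OF Suc.IH[of "y_inv q d y"]] by blast
    then show "x \<in> (\<Union>w\<in>{w. length w = Suc n}. x_map w ` slice (y_inv_word q w y))"
      using d(1) by (intro UN_I[of "d # w"] image_eqI[of _ _ x'']) simp_all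
  next
    fix x assume "x \<in> (\<Union>w\<in>{w. length w = Suc n}. x_map w ` slice (y_inv_word q w y))"
    then obtain u x'' where u: "length u = Suc n" "x = x_map u x''" "x'' \<in> slice (y_inv_word q u y)"
      by blast
    obtain d w where w: "length w = n" "u = d # w" using u(1) by (metis length_Suc_conv)
    have x'': "x = (x_map w x'' + digit_val d) / 3" "x'' \<in> slice (y_inv_word q w (y_inv q d y))"
      using u(2,3) w(2) by simp_all
    then have "x_map w x'' \<in> slice (y_inv q d y)"
      using equalityD2[OF Suc.IH[of "y_inv q d y"]] w(1) by blast
    then show "x \<in> slice y" using x''(1) slice_rec[of x y] by blast
  qed
qed simp

lemma x_map_slice: "x_map w ` slice (y_inv_word q w y) \<subseteq> slice y"
  using equalityD2[OF slice_words[of y "length w"]] by blast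

lemma uncountable_slice_of_word:
  assumes "uncountable (slice (y_inv_word q w y))"
  shows "uncountable (slice y)"
proof
  assume "countable (slice y)"
  then have "countable (x_map w ` slice (y_inv_word q w y))"
    by (rule countable_subset[OF x_map_slice])
  moreover have "inj_on (x_map w) (slice (y_inv_word q w y))"
  proof (rule inj_onI)
    fix x x' assume "x_map w x = x_map w x'"
    then show "x = x'" using x_map_dist[of w x x'] by simp
  qed
  ultimately show False using assms countable_image_inj_on by blast
qed


section \<open>Where slices branch\<close>

text \<open>
  Two uncountable parts of the slice at distance at least \<open>b - a\<close> are spread over finitely many cylinders of
  each level, so each meets one whose subslice is uncountable. The two cylinders are disjoint once
  the level makes them shorter than half of \<open>b - a\<close>.
\<close>

lemma uncountable_slice_splits:
  assumes "uncountable (slice y)"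
  obtains w v where "length w = length v" "x_map w 1 < x_map v 0"
    "uncountable (slice (y_inv_word q w y))" "uncountable (slice (y_inv_word q v y))"
proof -
  obtain a b where ab: "a < b" "uncountable (slice y \<inter> {..a})" "uncountable (slice y \<inter> {b..})"
    using uncountable_real_separated_parts[OF assms] compact_imp_bounded[OF compact_slice] by metis
  obtain n where n: "(1 / 3) ^ n < (b - a) / 2"
    using real_arch_pow_inv[of "(b - a) / 2" "1 / 3"] ab(1) by auto
  have pick: "\<exists>w. length w = n \<and> uncountable (slice (y_inv_word q w y)) \<and>
      (\<exists>x\<in>slice (y_inv_word q w y). x_map w x \<in> Z)" if "uncountable (slice y \<inter> Z)" for Z
  proof (rule ccontr)
    assume "\<nexists>w. length w = n \<and> uncountable (slice (y_inv_word q w y)) \<and>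
      (\<exists>x\<in>slice (y_inv_word q w y). x_map w x \<in> Z)"
    then have "countable (x_map w ` slice (y_inv_word q w y) \<inter> Z)" if "length w = n" for w
    proof (cases "countable (slice (y_inv_word q w y))")
      case False
      then have "x_map w ` slice (y_inv_word q w y) \<inter> Z = {}"
        using that \<open>\<nexists>w. _ w\<close> by blast
      then show ?thesis by simp
    qed simp
    then have "countable (\<Union>w\<in>{w. length w = n}. x_map w ` slice (y_inv_word q w y) \<inter> Z)"
      by (intro countable_UN) auto
    moreover have "slice y \<inter> Z = (\<Union>w\<in>{w. length w = n}. x_map w ` slice (y_inv_word q w y) \<inter> Z)"
      by (subst slice_words[of y n]) blast
    ultimately show False using that by simp
  qed
  obtain w x where w: "length w = n" "uncountable (slice (y_inv_word q w y))"
      "x \<in> slice (y_inv_word q w y)" "x_map w x \<le> a"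
    using pick[OF ab(2)] by auto
  obtain v z where v: "length v = n" "uncountable (slice (y_inv_word q v y))"
      "z \<in> slice (y_inv_word q v y)" "b \<le> x_map v z"
    using pick[OF ab(3)] by auto
  have x: "0 \<le> x" "z \<le> 1" using w(3) v(3) slice_subset_unit by force+
  have "x_map w 1 = x_map w 0 + (1 / 3) ^ n" "x_map v 1 = x_map v 0 + (1 / 3) ^ n"
    using x_map_affine[of w 1] x_map_affine[of v 1] w(1) v(1) by (simp_all add: power_one_over)
  moreover have "x_map w 0 \<le> x_map w x" "x_map v z \<le> x_map v 1"
    by (rule x_map_mono[OF x(1)], rule x_map_mono[OF x(2)])
  ultimately have "x_map w 1 < x_map v 0" using w(4) v(4) n by argo
  moreover have "length w = length v" using w(1) v(1) by simp
  ultimately show thesis using that w(2) v(2) by blast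
qed

text \<open>
  If uncountability is inherited by at most one digit at every step, then at each level at most one
  cylinder carries an uncountable part of the slice, which contradicts the splitting above.
\<close>

lemma countable_slice_of_unbranched:
  assumes P: "P y"
    and step: "\<And>z d. P z \<Longrightarrow> uncountable (slice (y_inv q d z)) \<Longrightarrow> P (y_inv q d z)"
    and unique: "\<And>z d e. P z \<Longrightarrow> uncountable (slice (y_inv q d z)) \<Longrightarrow>
                   uncountable (slice (y_inv q e z)) \<Longrightarrow> d = e"
  shows "countable (slice y)"
proof (rule ccontr)
  assume "uncountable (slice y)"
  then obtain w v where wv: "length w = length v" "x_map w 1 < x_map v 0"
    "uncountable (slice (y_inv_word q w y))" "uncountable (slice (y_inv_word q v y))"
    by (rule uncountable_slice_splits)
  have "w = v" using wv(1,3,4) P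
  proof (induction w v arbitrary: y rule: list_induct2)
    case (Cons d w e v)
    have "uncountable (slice (y_inv q d y))" "uncountable (slice (y_inv q e y))"
      using Cons.prems(1,2) uncountable_slice_of_word by (metis y_inv_word.simps(2))+
    then have "d = e" "P (y_inv q d y)" using Cons.prems(3) unique step by blast+
    then show ?case using Cons.IH[of "y_inv q d y"] Cons.prems by simp
  qed simp
  then show False using wv(2) x_map_mono[of 0 1 w] by simp
qed

lemma switch_iff: "y \<in> switch \<longleftrightarrow> q - 1 \<le> q * y \<and> q * y \<le> 1"
  using q by (auto simp: switch_def field_simps)

lemma y_inv_unit_iff:
  "y_inv q Lo y \<in> {0..1} \<longleftrightarrow> 0 \<le> q * y \<and> q * y \<le> 1"
  "y_inv q Mid y \<in> {0..1} \<longleftrightarrow> q - 1 \<le> q * y \<and> q * y \<le> 1"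
  "y_inv q Hi y \<in> {0..1} \<longleftrightarrow> q - 1 \<le> q * y \<and> q * y \<le> q"
proof -
  have "0 < 2 - q" using q by simp
  then have "(1 - q * y) / (2 - q) \<le> 1 \<longleftrightarrow> 1 - q * y \<le> 2 - q" by (rule divide_le_eq_1_pos)
  moreover have "0 \<le> (1 - q * y) / (2 - q) \<longleftrightarrow> 0 \<le> 1 - q * y"
    using q by (simp add: zero_le_divide_iff)
  ultimately show "y_inv q Mid y \<in> {0..1} \<longleftrightarrow> q - 1 \<le> q * y \<and> q * y \<le> 1"
    unfolding y_inv.simps atLeastAtMost_iff by linarith
qed (unfold y_inv.simps atLeastAtMost_iff, linarith+)

lemma y_inv_in_unit_switch:
  assumes "y \<in> switch"
  shows "y_inv q d y \<in> {0..1}"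
proof -
  have "q - 1 \<le> q * y" "q * y \<le> 1" using assms by (auto simp: switch_iff)
  then have "y_inv q Lo y \<in> {0..1}" "y_inv q Mid y \<in> {0..1}" "y_inv q Hi y \<in> {0..1}"
    unfolding y_inv_unit_iff using q by linarith+
  then show ?thesis by (cases d) simp_all
qed

lemma y_inv_unique_off_switch:
  assumes "y \<notin> switch" "y_inv q d y \<in> {0..1}" "y_inv q e y \<in> {0..1}"
  shows "d = e"
  using assms unfolding switch_iff
  by (cases d; cases e; simp only: y_inv_unit_iff digit.distinct simp_thms; linarith)

text \<open>
  Both endpoints are fixed points of the only inverse that keeps them in \<open>[0, 1]\<close>.
\<close>

lemma countable_slice_endpoint:
  assumes "y \<in> {0, 1}"
  shows "countable (slice y)"
proof (rule countable_slice_of_unbranched[where P = "\<lambda>z. z \<in> {0, 1}"])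
  fix z d assume z: "z \<in> {0, 1 :: real}" "uncountable (slice (y_inv q d z))"
  then have "y_inv q d z \<in> {0..1}" using slice_outside by fastforce
  then show "y_inv q d z \<in> {0, 1}" using z(1) q by (cases d) (auto simp: field_simps)
next
  fix z d e assume z: "z \<in> {0, 1 :: real}" "uncountable (slice (y_inv q d z))"
    "uncountable (slice (y_inv q e z))"
  then have "y_inv q d z \<in> {0..1}" "y_inv q e z \<in> {0..1}" using slice_outside by fastforce+
  then show "d = e" using z(1) q by (intro y_inv_unique_off_switch[of z]) (auto simp: switch_def field_simps)
qed (rule assms)

text \<open>
  An orbit that avoids the interior of the switch region can branch only at \<open>1/q\<close> and \<open>1 - 1/q\<close>. There
  two of the three successors are \<open>0\<close> and \<open>1\<close>, whose slices are countable, so uncountability is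
  inherited by at most one digit.
\<close>

lemma uncountable_slice_reaches_switch_interior:
  assumes "uncountable (slice y)"
  obtains w where "y_inv_word q w y \<in> switch_interior"
proof -
  define P where "P z \<longleftrightarrow> (\<forall>w. y_inv_word q w z \<notin> switch_interior)" for z
  have "countable (slice y)" if "P y"
  proof (rule countable_slice_of_unbranched[of P, OF that])
    fix z d assume "P z"
    show "P (y_inv q d z)" unfolding P_def
    proof
      fix w show "y_inv_word q w (y_inv q d z) \<notin> switch_interior"
        using \<open>P z\<close>[unfolded P_def, rule_format, of "d # w"] by simp
    qed
  next
    fix z d e
    assume z: "P z" and d: "uncountable (slice (y_inv q d z))" and e: "uncountable (slice (y_inv q e z))"
    have de: "y_inv q d z \<in> {0..1}" "y_inv q e z \<in> {0..1}" using d e slice_outside by fastforce+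
    have ends: "y_inv q d z \<notin> {0, 1}" "y_inv q e z \<notin> {0, 1}"
      using d e countable_slice_endpoint by blast+
    have "z \<notin> switch_interior" using z[unfolded P_def, rule_format, of "[]"] by simp
    then consider "z \<notin> switch" | "z = 1 / q" | "z = 1 - 1 / q"
      by (force simp: switch_def switch_interior_def)
    then show "d = e"
    proof cases
      case 1
      then show ?thesis using de y_inv_unique_off_switch by blast
    next
      case 2
      then have "y_inv q Lo z = 1" "y_inv q Mid z = 0" using q by simp_all
      then show ?thesis using ends by (cases d; cases e; simp)
    next
      case 3
      have "y_inv q Mid z = 1" "y_inv q Hi z = 0" using q 3 by (auto simp: field_simps)
      then show ?thesis using ends by (cases d; cases e; simp)
    qed
  qed
  then show thesis using that assms by (auto simp: P_def)
qed

end


section \<open>Uniform branching and the dimension bound\<close>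

locale okamoto_dichotomy = okamoto +
  assumes dichotomy: "y \<in> {0..1} \<Longrightarrow> is_singleton (slice y) \<or> uncountable (slice y)"
begin

lemma slice_nonempty: "y \<in> {0..1} \<Longrightarrow> slice y \<noteq> {}"
  using dichotomy[of y] by (auto simp: is_singleton_def)

lemma uncountable_slice_switch:
  assumes "y \<in> switch"
  shows "uncountable (slice y)"
proof -
  obtain x where x: "x \<in> slice (y_inv q Lo y)"
    using slice_nonempty y_inv_in_unit_switch[OF assms] by blast
  obtain z where z: "z \<in> slice (y_inv q Hi y)"
    using slice_nonempty y_inv_in_unit_switch[OF assms] by blast
  have mem: "x / 3 \<in> slice y" "(z + 2) / 3 \<in> slice y"
    using x_map_slice[of "[Lo]" y] x_map_slice[of "[Hi]" y] x z by auto
  have "x \<le> 1" "0 \<le> z"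
    using subsetD[OF slice_subset_unit x] subsetD[OF slice_subset_unit z] by simp_all
  then have "x / 3 \<noteq> (z + 2) / 3" by simp
  with mem have "\<not> is_singleton (slice y)" by (metis is_singletonE singletonD)
  moreover have "y \<in> {0..1}" using mem(1) slice_outside by blast
  ultimately show ?thesis using dichotomy by blast
qed

lemma switch_branches:
  assumes "y \<in> switch"
  obtains w v where "x_map w 1 < x_map v 0"
    "y_inv_word q w y \<in> switch_interior" "y_inv_word q v y \<in> switch_interior"
proof -
  obtain w v where wv: "x_map w 1 < x_map v 0"
    "uncountable (slice (y_inv_word q w y))" "uncountable (slice (y_inv_word q v y))"
    using uncountable_slice_splits[OF uncountable_slice_switch[OF assms]] by metis
  obtain w' v' where "y_inv_word q w' (y_inv_word q w y) \<in> switch_interior"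
    "y_inv_word q v' (y_inv_word q v y) \<in> switch_interior"
    using uncountable_slice_reaches_switch_interior wv(2,3) by metis
  moreover have "x_map (w @ w') 1 < x_map (v @ v') 0"
  proof -
    have "x_map w (x_map w' 1) \<le> x_map w 1" "x_map v 0 \<le> x_map v (x_map v' 0)"
      using x_map_in_unit[of 1 w'] x_map_in_unit[of 0 v'] by (auto intro: x_map_mono)
    then show ?thesis using wv(1) by (simp add: x_map_append)
  qed
  ultimately show thesis using that by (simp add: y_inv_word_append)
qed

text \<open>
  For a fixed pair of words, the points sent by both words into the interior of the switch region
  form an open set, and these sets cover the compact switch region.
\<close>

lemma switch_branches_uniformly:
  obtains N g where "0 < g"
    "\<And>y. y \<in> switch \<Longrightarrow> \<exists>w v. length w \<le> N \<and> length v \<le> N \<and> x_map w 1 + g \<le> x_map v 0 \<and>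
       y_inv_word q w y \<in> switch \<and> y_inv_word q v y \<in> switch"
proof -
  define W where "W = {p. x_map (fst p) 1 < x_map (snd p) 0}"
  define O' where "O' p = y_inv_word q (fst p) -` switch_interior \<inter> y_inv_word q (snd p) -` switch_interior"
    for p
  have "open (O' p)" for p
    unfolding O'_def by (intro open_Int open_vimage continuous_on_y_inv_word) (auto simp: switch_interior_def)
  moreover have "switch \<subseteq> (\<Union>p\<in>W. O' p)"
  proof
    fix y assume "y \<in> switch"
    then obtain w v where "x_map w 1 < x_map v 0"
      "y_inv_word q w y \<in> switch_interior" "y_inv_word q v y \<in> switch_interior"
      by (rule switch_branches)
    then show "y \<in> (\<Union>p\<in>W. O' p)" by (intro UN_I[of "(w, v)"]) (auto simp: W_def O'_def)
  qed
  moreover have "compact switch" by (simp add: switch_def)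
  ultimately obtain F where F: "F \<subseteq> W" "finite F" "switch \<subseteq> (\<Union>p\<in>F. O' p)"
    by (meson compactE_image)
  define N where "N = Max (insert 0 ((\<lambda>p. max (length (fst p)) (length (snd p))) ` F))"
  define g where "g = Min (insert 1 ((\<lambda>p. x_map (snd p) 0 - x_map (fst p) 1) ` F))"
  have "0 < g" unfolding g_def using F(1,2) by (subst Min_gr_iff) (auto simp: W_def)
  moreover have "\<exists>w v. length w \<le> N \<and> length v \<le> N \<and> x_map w 1 + g \<le> x_map v 0 \<and>
       y_inv_word q w y \<in> switch \<and> y_inv_word q v y \<in> switch" if y: "y \<in> switch" for y
  proof -
    obtain p where p: "p \<in> F" "y \<in> O' p" using subsetD[OF F(3) y] by (rule UN_E)
    have "max (length (fst p)) (length (snd p)) \<le> N" unfolding N_def using F(2) p(1) by (intro Max_ge) auto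
    moreover have "g \<le> x_map (snd p) 0 - x_map (fst p) 1"
      unfolding g_def using F(2) p(1) by (intro Min_le) auto
    moreover have "y_inv_word q (fst p) y \<in> switch" "y_inv_word q (snd p) y \<in> switch"
      using p(2) by (auto simp: O'_def switch_def switch_interior_def)
    ultimately show ?thesis by (intro exI[of _ "fst p"] exI[of _ "snd p"]) auto
  qed
  ultimately show thesis using that by blast
qed

text \<open>
  Zooming into the cylinder of \<open>w\<close>: only the balls that meet the cylinder matter there.
\<close>

lemma cover_of_subslice:
  assumes "slice y \<subseteq> (\<Union>i\<in>F. cball (p i) (r i))"
  shows "slice (y_inv_word q w y) \<subseteq>
    (\<Union>i\<in>{i\<in>F. cball (p i) (r i) \<inter> x_map w ` {0..1} \<noteq> {}}.
        cball (3 ^ length w * (p i - x_map w 0)) (3 ^ length w * r i))"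
proof
  fix x assume x: "x \<in> slice (y_inv_word q w y)"
  then have "x_map w x \<in> slice y" using x_map_slice by blast
  then obtain i where i: "i \<in> F" "x_map w x \<in> cball (p i) (r i)" using assms by blast
  have "3 ^ length w * (p i - x_map w 0) - x = 3 ^ length w * (p i - (x_map w 0 + x / 3 ^ length w))"
    by (simp add: field_simps)
  then have "3 ^ length w * (p i - x_map w 0) - x = 3 ^ length w * (p i - x_map w x)"
    by (simp only: x_map_affine[of w x, symmetric])
  then have "\<bar>3 ^ length w * (p i - x_map w 0) - x\<bar> = 3 ^ length w * \<bar>p i - x_map w x\<bar>"
    by (simp add: abs_mult)
  also have "\<dots> \<le> 3 ^ length w * r i" using i(2) by (simp add: dist_real_def)
  finally have "x \<in> cball (3 ^ length w * (p i - x_map w 0)) (3 ^ length w * r i)"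
    by (simp add: dist_real_def)
  moreover have "x_map w x \<in> x_map w ` {0..1}" using x slice_subset_unit by blast
  ultimately show "x \<in> (\<Union>i\<in>{i\<in>F. cball (p i) (r i) \<inter> x_map w ` {0..1} \<noteq> {}}.
        cball (3 ^ length w * (p i - x_map w 0)) (3 ^ length w * r i))"
    using i by blast
qed

text \<open>
  The induction is on the number of balls. A ball of radius at least \<open>g / 2\<close> already gives the bound.
  Otherwise no ball meets both of the separated cylinders, so the balls meeting one of them are
  fewer in number and, after rescaling, cover a slice over the switch region. The condition on \<open>s\<close> makes
  each of the two cylinders contribute at least half of the bound.
\<close>

lemma switch_slice_cover_bound:
  assumes g: "0 < g"
    and branch: "\<And>y. y \<in> switch \<Longrightarrow> \<exists>w v. length w \<le> N \<and> length v \<le> N \<and>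
       x_map w 1 + g \<le> x_map v 0 \<and> y_inv_word q w y \<in> switch \<and> y_inv_word q v y \<in> switch"
    and s: "0 < s" "(3 ^ N) powr s \<le> 2"
    and y: "y \<in> switch" and F: "finite F"
    and cover: "slice y \<subseteq> (\<Union>i\<in>F. cball (p i) (r i))"
  shows "(g / 2) powr s \<le> (\<Sum>i\<in>F. r i powr s)"
  using y F cover
proof (induction "card F" arbitrary: F y p r rule: less_induct)
  case less
  show ?case
  proof (cases "\<exists>i\<in>F. g / 2 \<le> r i")
    case True
    then obtain i where i: "i \<in> F" "g / 2 \<le> r i" by blast
    have "(g / 2) powr s \<le> r i powr s" using i(2) g s by (intro powr_mono2) auto
    also have "\<dots> \<le> (\<Sum>i\<in>F. r i powr s)" using i(1) less.prems(2) by (intro member_le_sum) auto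
    finally show ?thesis .
  next
    case False
    obtain w v where wv: "length w \<le> N" "length v \<le> N" "x_map w 1 + g \<le> x_map v 0"
      "y_inv_word q w y \<in> switch" "y_inv_word q v y \<in> switch"
      using branch[OF less.prems(1)] by blast
    define part where "part u = {i\<in>F. cball (p i) (r i) \<inter> x_map u ` {0..1} \<noteq> {}}" for u
    have fin: "finite (part u)" and sub: "part u \<subseteq> F" for u
      using less.prems(2) by (auto simp: part_def)
    have disj: "part w \<inter> part v = {}"
    proof (rule ccontr)
      assume "part w \<inter> part v \<noteq> {}"
      then obtain i a b where i: "i \<in> F" "x_map w a \<in> cball (p i) (r i)" "x_map v b \<in> cball (p i) (r i)"
        "a \<le> 1" "0 \<le> b" by (force simp: part_def)
      have "x_map w a \<le> x_map w 1" "x_map v 0 \<le> x_map v b" using i(4,5) by (auto intro: x_map_mono)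
      then have "g \<le> 2 * r i" using i(2,3) wv(3) by (auto simp: dist_real_def)
      then show False using False i(1) by auto
    qed
    have covu: "slice (y_inv_word q u y) \<subseteq>
        (\<Union>i\<in>part u. cball (3 ^ length u * (p i - x_map u 0)) (3 ^ length u * r i))" for u
      unfolding part_def by (rule cover_of_subslice[OF less.prems(3)])
    have ne: "part u \<noteq> {}" if "y_inv_word q u y \<in> switch" for u
      using covu[of u] uncountable_slice_switch[OF that] by auto
    have half: "(g / 2) powr s / 2 \<le> (\<Sum>i\<in>part u. r i powr s)"
      if u: "length u \<le> N" "y_inv_word q u y \<in> switch" "part u \<subset> F" for u
    proof -
      have "(3 ^ length u) powr s \<le> (3 ^ N) powr s"
        using u(1) s(1) by (intro powr_mono2 power_increasing) auto
      also note s(2)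
      finally have le2: "(3 ^ length u) powr s \<le> 2" .
      have "(g / 2) powr s \<le> (\<Sum>i\<in>part u. (3 ^ length u * r i) powr s)"
        using less.hyps[OF psubset_card_mono[OF less.prems(2) u(3)] u(2) fin covu] .
      also have "\<dots> = (3 ^ length u) powr s * (\<Sum>i\<in>part u. r i powr s)"
        by (simp add: powr_mult sum_distrib_left)
      also have "\<dots> \<le> 2 * (\<Sum>i\<in>part u. r i powr s)"
        using le2 by (intro mult_right_mono sum_nonneg) auto
      finally show ?thesis by simp
    qed
    have "part w \<subset> F" "part v \<subset> F" using ne[OF wv(4)] ne[OF wv(5)] disj sub[of w] sub[of v] by auto
    then have "(g / 2) powr s \<le> (\<Sum>i\<in>part w. r i powr s) + (\<Sum>i\<in>part v. r i powr s)"
      using half[OF wv(1,4)] half[OF wv(2,5)] by simp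
    also have "\<dots> = (\<Sum>i\<in>part w \<union> part v. r i powr s)"
      using disj fin by (simp add: sum.union_disjoint)
    also have "\<dots> \<le> (\<Sum>i\<in>F. r i powr s)"
      using sub less.prems(2) by (intro sum_mono2) auto
    finally show ?thesis .
  qed
qed

lemma uniform_dim_bound:
  "\<exists>s>0. \<forall>y. uncountable (slice y) \<longrightarrow> ennreal s \<le> hausdorff_dim (slice y)"
proof -
  obtain N g where g: "0 < g"
    and branch: "\<And>y. y \<in> switch \<Longrightarrow> \<exists>w v. length w \<le> N \<and> length v \<le> N \<and>
       x_map w 1 + g \<le> x_map v 0 \<and> y_inv_word q w y \<in> switch \<and> y_inv_word q v y \<in> switch"
    using switch_branches_uniformly by metis
  define s where "s = ln 2 / (real (Suc N) * ln 3)"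
  have s: "0 < s" by (simp add: s_def)
  have "(3 ^ N) powr s \<le> (3 ^ Suc N) powr s" using s by (intro powr_mono2 power_increasing) auto
  also have "\<dots> = 2"
  proof -
    have "s * ln (3 ^ Suc N) = ln 2" by (subst ln_realpow) (auto simp: s_def)
    then show ?thesis by (simp add: powr_def)
  qed
  finally have sN: "(3 ^ N) powr s \<le> 2" .
  have "ennreal s \<le> hausdorff_dim (slice y)" if y: "uncountable (slice y)" for y
  proof -
    obtain w where "y_inv_word q w y \<in> switch_interior"
      using uncountable_slice_reaches_switch_interior[OF y] .
    then have w: "y_inv_word q w y \<in> switch" by (auto simp: switch_def switch_interior_def)
    define c where "c = (g / 2) powr s / (3 ^ length w) powr s"
    show ?thesis
    proof (rule hausdorff_dim_ge_of_finite_ball_covers[OF compact_slice s])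
      show "0 < c" using g by (simp add: c_def)
    next
      fix F :: "nat set" and p r assume F: "finite F" "slice y \<subseteq> (\<Union>i\<in>F. cball (p i) (r i))"
      define F' where "F' = {i\<in>F. cball (p i) (r i) \<inter> x_map w ` {0..1} \<noteq> {}}"
      have "(g / 2) powr s \<le> (\<Sum>i\<in>F'. (3 ^ length w * r i) powr s)"
        using switch_slice_cover_bound[OF g branch s sN w _ cover_of_subslice[OF F(2)]] F(1)
        by (simp add: F'_def)
      also have "\<dots> = (3 ^ length w) powr s * (\<Sum>i\<in>F'. r i powr s)"
        by (simp add: powr_mult sum_distrib_left)
      finally have "c \<le> (\<Sum>i\<in>F'. r i powr s)" by (simp add: c_def field_simps)
      also have "\<dots> \<le> (\<Sum>i\<in>F. r i powr s)" using F(1) by (intro sum_mono2) (auto simp: F'_def)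
      finally show "c \<le> (\<Sum>i\<in>F. r i powr s)" .
    qed
  qed
  then show ?thesis using s by blast
qed

end

theorem theorem2:
  fixes q :: real
  assumes "q \<in> {1<..<2}"
    and "\<forall>y\<in>{0..1}. card (okamoto_slice q y) = 1 \<or> okamoto_slice q y \<approx> (UNIV :: real set)"
  shows "\<exists>s>0. \<forall>y\<in>{0..1}. uncountable (okamoto_slice q y) \<longrightarrow>
           hausdorff_dim (okamoto_slice q y) \<ge> ennreal s"
proof -
  interpret okamoto_dichotomy q
  proof
    fix y :: real assume "y \<in> {0..1}"
    then consider "card (okamoto_slice q y) = 1" | "okamoto_slice q y \<approx> (UNIV :: real set)"
      using assms(2) by blast
    then show "is_singleton (okamoto_slice q y) \<or> uncountable (okamoto_slice q y)"
    proof cases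
      case 1
      then show ?thesis by (simp add: is_singleton_altdef)
    next
      case 2
      then show ?thesis using uncountable_UNIV_real countable_eqpoll eqpoll_sym by blast
    qed
  qed (use assms(1) in auto)
  show ?thesis using uniform_dim_bound by blast
qed

end
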